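(* Let $m\ge 2$, $n=2^m$, let $\alpha_1,\dots,\alpha_n$ be an enumeration of all elements of $F^m=\{0,1\}^m$, and let $f:F^m\to F^m$ be a one-to-one APN operator such that the system $$a+b+c+d=0,\qquad a+b+e+t=0,\qquad f(a)+f(b)+f(c)+f(d)+f(e)+f(t)=0$$ has no solutions with pairwise different $a,b,c,d,e,t\in F^m$. Let $$P=\Big\{x\in F^n:\sum_{i=1}^n x_i=0,\ \sum_{i=1}^n x_i\alpha_i=0^m\Big\},\qquad Q=\Big\{x\in F^n:\sum_{i=1}^n x_i=1,\ \sum_{i=1}^n x_i f(\alpha_i)=0^m\Big\},$$ and let $q:P\to Q$ be the map assigning to each $p\in P$ the unique word $q(p)\in Q$ with $d_H(p,q(p))=1$. Then the code $$\overline{P}=\{(a+b+q(b),\,a+q(b)) : a,b\in P\}$$ is a binary distance $6$ code of length $2n$ and cardinality $2^{2n-2}/n^2$.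
   Context: $F^k=\{0,1\}^k$ is the set of binary words of length $k$, with coordinatewise addition mod $2$; $d_H$ is the Hamming distance (number of positions in which two words differ). For $u,v\in F^n$, $(u,v)\in F^{2n}$ is the concatenation. An operator $f:F^m\to F^m$ is APN (almost perfect nonlinear) if for every $(a,b)\ne(0^m,0^m)$ in $F^m\times F^m$ the system $x+y=a$, $f(x)+f(y)=b$ has $0$ or $2$ solutions $(x,y)\in F^m\times F^m$. A set $C$ of binary words of the same length is a distance $d$ code if $|C|\ge 2$ and $d$ is the minimal Hamming distance between two different words of $C$. *)

theory Defs
  imports "HOL-Analysis.Analysis" "HOL-Library.Z2"
begin

text \<open>
  A word of length \<open>k\<close> over \<open>{0,1}\<close> is a vector of type \<open>bit ^ 'k\<close> with \<open>CARD('k) = k\<close>, so that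
  \<open>+\<close> is coordinatewise addition modulo 2.
\<close>

instance bit :: finite
proof
  have "(UNIV :: bit set) \<subseteq> {0, 1}" by (auto intro: bit.exhaust)
  then show "finite (UNIV :: bit set)" by (rule finite_subset) simp
qed

definition hamming_dist :: "bit ^ 'k \<Rightarrow> bit ^ 'k \<Rightarrow> nat" where
  "hamming_dist x y = card {i. x $ i \<noteq> y $ i}"

definition concat_words :: "bit ^ 'k \<Rightarrow> bit ^ 'l \<Rightarrow> bit ^ ('k + 'l)" where
  "concat_words u v = (\<chi> i. case i of Inl j \<Rightarrow> u $ j | Inr j \<Rightarrow> v $ j)"

definition distance_code :: "nat \<Rightarrow> (bit ^ 'k) set \<Rightarrow> bool" where
  "distance_code d C \<longleftrightarrow>
     card C \<ge> 2 \<and> d = Min {hamming_dist x y | x y. x \<in> C \<and> y \<in> C \<and> x \<noteq> y}"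

definition APN :: "(bit ^ 'm \<Rightarrow> bit ^ 'm) \<Rightarrow> bool" where
  "APN f \<longleftrightarrow> (\<forall>a b. (a, b) \<noteq> (0, 0) \<longrightarrow> card {(x, y). x + y = a \<and> f x + f y = b} \<in> {0, 2})"

definition code_P :: "('n::finite \<Rightarrow> bit ^ 'm) \<Rightarrow> (bit ^ 'n) set" where
  "code_P \<alpha> = {x. (\<Sum>i\<in>UNIV. x $ i) = 0 \<and> (\<Sum>i\<in>UNIV. x $ i *s \<alpha> i) = 0}"

definition code_Q ::
  "('n::finite \<Rightarrow> bit ^ 'm) \<Rightarrow> (bit ^ 'm \<Rightarrow> bit ^ 'm) \<Rightarrow> (bit ^ 'n) set" where
  "code_Q \<alpha> f = {x. (\<Sum>i\<in>UNIV. x $ i) = 1 \<and> (\<Sum>i\<in>UNIV. x $ i *s f (\<alpha> i)) = 0}"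

definition q_map ::
  "('n::finite \<Rightarrow> bit ^ 'm) \<Rightarrow> (bit ^ 'm \<Rightarrow> bit ^ 'm) \<Rightarrow> bit ^ 'n \<Rightarrow> bit ^ 'n" where
  "q_map \<alpha> f p = (THE r. r \<in> code_Q \<alpha> f \<and> hamming_dist p r = 1)"

text \<open>The definite description in \<^const>\<open>q_map\<close> is proper on \<^const>\<open>code_P\<close>.\<close>

lemma hamming_dist_1_iff:
  fixes p r :: "bit ^ 'k::finite"
  shows "hamming_dist p r = 1 \<longleftrightarrow> (\<exists>i. r = p + axis i 1)"
proof
  assume "hamming_dist p r = 1"
  then obtain i where i: "{i. p $ i \<noteq> r $ i} = {i}"
    unfolding hamming_dist_def by (metis card_1_singletonE)
  have "r $ j = (p + axis i 1) $ j" for j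
  proof (cases "j = i")
    case True
    moreover have "p $ i \<noteq> r $ i" using i by auto
    ultimately show ?thesis
      by (cases "p $ i"; cases "r $ i") (auto simp: axis_def)
  next
    case False
    then have "p $ j = r $ j" using i by auto
    then show ?thesis using False by (auto simp: axis_def)
  qed
  then show "\<exists>i. r = p + axis i 1" by (auto simp: vec_eq_iff)
next
  assume "\<exists>i. r = p + axis i 1"
  then obtain i where "r = p + axis i 1" ..
  then have "{j. p $ j \<noteq> r $ j} = {i}" by (auto simp: axis_def)
  then show "hamming_dist p r = 1" by (simp add: hamming_dist_def)
qed

lemma q_map_well_defined:
  fixes \<alpha> :: "'n::finite \<Rightarrow> bit ^ 'm::finite"
  assumes "bij \<alpha>" and "inj f" and p: "p \<in> code_P \<alpha>"
  shows "\<exists>!r. r \<in> code_Q \<alpha> f \<and> hamming_dist p r = 1"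
proof -
  let ?g = "\<lambda>i. f (\<alpha> i)" and ?s = "\<Sum>i\<in>UNIV. p $ i *s f (\<alpha> i)"
  have "bij f" using \<open>inj f\<close> by (simp add: bij_def finite_UNIV_inj_surj)
  with \<open>bij \<alpha>\<close> have g: "bij ?g" using bij_comp[of \<alpha> f] by (simp add: comp_def)
  have axis: "(\<Sum>j\<in>UNIV. axis i (1::bit) $ j *s ?g j) = ?g i" for i
  proof -
    have "axis i (1::bit) $ j *s ?g j = (if j = i then ?g j else 0)" for j
      by (simp add: axis_def vec_eq_iff)
    then show ?thesis by simp
  qed
  have one: "(\<Sum>j\<in>UNIV. axis i (1::bit) $ j) = 1" for i :: 'n
    by (simp add: axis_def)
  have Q: "p + axis i 1 \<in> code_Q \<alpha> f \<longleftrightarrow> ?g i = ?s" for i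
  proof -
    have neg: "u + v = 0 \<longleftrightarrow> v = u" for u v :: "bit ^ 'm"
    proof -
      have "x + y = 0 \<longleftrightarrow> y = x" for x y :: bit by (cases x; cases y) auto
      then show ?thesis by (simp add: vec_eq_iff)
    qed
    have "(\<Sum>j\<in>UNIV. (p + axis i 1) $ j *s ?g j) = ?s + (\<Sum>j\<in>UNIV. axis i 1 $ j *s ?g j)"
      by (simp only: vector_add_component vector_sadd_rdistrib sum.distrib)
    then have "(\<Sum>j\<in>UNIV. (p + axis i 1) $ j *s ?g j) = ?s + ?g i"
      by (simp only: axis)
    moreover have "(\<Sum>j\<in>UNIV. (p + axis i 1) $ j) = 1"
      using p by (simp only: code_P_def vector_add_component sum.distrib one mem_Collect_eq add_0_left)
    ultimately show ?thesis by (simp only: code_Q_def neg mem_Collect_eq simp_thms)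
  qed
  obtain k where k: "?g k = ?s"
    using bij_is_surj[OF g] by (metis surjD)
  show ?thesis
  proof (rule ex1I)
    show "p + axis k 1 \<in> code_Q \<alpha> f \<and> hamming_dist p (p + axis k 1) = 1"
      using Q k hamming_dist_1_iff by blast
  next
    fix r assume r: "r \<in> code_Q \<alpha> f \<and> hamming_dist p r = 1"
    then obtain i where i: "r = p + axis i 1"
      using hamming_dist_1_iff by blast
    with r Q have "?g i = ?s" by blast
    with k have "?g i = ?g k" by (simp only:)
    then have "i = k" using bij_is_inj[OF g] by (rule injD[rotated])
    with i show "r = p + axis k 1" by (simp only:)
  qed
qed

end

theory Submission
  imports Defs
begin

text \<open>
  For \<open>b \<in> P\<close> the word \<open>q(b)\<close> is \<open>b + e\<^sub>i\<close>, where the position \<open>i\<close> is determined by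
  \<open>f(\<alpha>\<^sub>i) = S(b)\<close>, with \<open>S(b) = \<Sum>\<^sub>k b\<^sub>k f(\<alpha>\<^sub>k)\<close> (\<open>q_map_eq_add_axis\<close>). The codeword of \<open>(a, b)\<close> is
  therefore \<open>(a + e\<^sub>i, a + b + e\<^sub>i)\<close>. As \<open>P\<close> is closed under addition and \<open>S\<close> is additive, two
  codewords differ by
  \<open>(A + e\<^sub>i + e\<^sub>j, A + B + e\<^sub>i + e\<^sub>j)\<close> with \<open>A, B \<in> P\<close> and \<open>f(\<alpha>\<^sub>i) + f(\<alpha>\<^sub>j) = S(B)\<close>. The code need not be
  linear, but its distances are weights of words of this shape (\<open>difference_weight_ge_6\<close>):

  \<^item> If \<open>i = j\<close> and \<open>B = 0\<close>, the difference is \<open>(A, A)\<close>, of weight at least \<open>2 \<cdot> 4\<close>, because \<open>P\<close> is an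
    extended Hamming code.
  \<^item> If \<open>i = j\<close> and \<open>B \<noteq> 0\<close>, then \<open>S(B) = 0\<close>, and the APN property says exactly that such a \<open>B\<close>
    has weight different from \<open>4\<close>, hence at least \<open>6\<close>. The two halves have sum \<open>B\<close>, so
    together they weigh at least as much.
  \<^item> If \<open>i \<noteq> j\<close>, both halves have even weight and are nonzero, as \<open>P\<close> has no words of weight
    \<open>2\<close>. Total weight below \<open>6\<close> would force the halves to be \<open>e\<^sub>k + e\<^sub>l\<close> and \<open>e\<^sub>r + e\<^sub>s\<close>. Then the three
    pairs \<open>{\<alpha>\<^sub>i, \<alpha>\<^sub>j}\<close>, \<open>{\<alpha>\<^sub>k, \<alpha>\<^sub>l}\<close>, \<open>{\<alpha>\<^sub>r, \<alpha>\<^sub>s}\<close> have the same sum, and the sum of \<open>f\<close> over all six is zero: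
    a solution of the forbidden system once the pairs are known to be disjoint
    (\<open>equal_sum_pairs_distinct\<close>).

  Distance \<open>6\<close> occurs between the codeword of \<open>(0, 0)\<close> and that of \<open>(0, B)\<close>, for \<open>B\<close> the indicator
  of an affine plane through the point that \<open>f\<close> maps to \<open>0\<close> (\<open>ex_weight_6_difference\<close>). For the
  cardinality, \<open>a\<close> and \<open>b\<close> can be recovered from the codeword, since its halves have sum \<open>b\<close>; so
  there are \<open>|P|\<^sup>2\<close> codewords, and \<open>|P| = 2\<^sup>n / (2n)\<close> because the \<open>m + 1\<close> parity checks defining \<open>P\<close>
  are independent (\<open>code_P_card\<close>).
\<close>

section \<open>Binary words and their supports\<close>

lemma bit_word_add_self [simp]:
  fixes u :: "bit ^ 'k"
  shows "u + u = 0"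
  by (simp add: vec_eq_iff)

lemma bit_word_add_self_left [simp]:
  fixes u v :: "bit ^ 'k"
  shows "u + (u + v) = v"
  by (simp flip: add.assoc)

lemma bit_word_minus [simp]:
  fixes u v :: "bit ^ 'k"
  shows "u - v = u + v"
  by (simp add: diff_eq_eq add.assoc)

lemma bit_word_add_eq_0_iff:
  fixes u v :: "bit ^ 'k"
  shows "u + v = 0 \<longleftrightarrow> u = v"
  by (metis bit_word_minus right_minus_eq)

definition support :: "bit ^ 'k \<Rightarrow> 'k set" where
  "support x = {i. x $ i = 1}"

lemma support_add: "support (x + y) = sym_diff (support x) (support y)"
proof -
  have "s + t = 1 \<longleftrightarrow> (s = 1) \<noteq> (t = 1)" for s t :: bit
    by (cases s; cases t) auto
  then show ?thesis by (auto simp: support_def)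
qed

lemma support_axis [simp]: "support (axis i 1) = {i}"
  by (auto simp: support_def axis_def)

lemma support_0 [simp]: "support 0 = {}"
  by (simp add: support_def)

lemma support_inject: "support x = support y \<longleftrightarrow> x = y"
proof
  assume "support x = support y"
  then have "x $ i = 1 \<longleftrightarrow> y $ i = 1" for i by (auto simp: support_def)
  then have "x $ i = y $ i" for i by (metis bit.exhaust)
  then show "x = y" by (simp add: vec_eq_iff)
qed simp

lemma support_eq_empty_iff [simp]: "support x = {} \<longleftrightarrow> x = 0"
  using support_inject[of x 0] by simp

lemma hamming_dist_eq_card_support: "hamming_dist x y = card (support (x + y))"
proof -
  have "s \<noteq> t \<longleftrightarrow> s + t = 1" for s t :: bit
    by (cases s; cases t) auto
  then have "{i. x $ i \<noteq> y $ i} = support (x + y)" by (simp only: support_def vector_add_component)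
  then show ?thesis by (simp only: hamming_dist_def)
qed

lemma card_support_le_add:
  fixes x y :: "bit ^ 'k::finite"
  shows "card (support y) \<le> card (support x) + card (support (x + y))"
proof -
  have "support y \<subseteq> support x \<union> support (x + y)" by (auto simp: support_add)
  then have "card (support y) \<le> card (support x \<union> support (x + y))"
    by (intro card_mono) auto
  also have "\<dots> \<le> card (support x) + card (support (x + y))" by (rule card_Un_le)
  finally show ?thesis .
qed

lemma concat_words_inject: "concat_words u v = concat_words u' v' \<longleftrightarrow> u = u' \<and> v = v'"
  by (auto simp: concat_words_def vec_eq_iff split: sum.splits)

lemma hamming_dist_concat_words:
  fixes u u' :: "bit ^ 'k::finite" and v v' :: "bit ^ 'l::finite"
  shows "hamming_dist (concat_words u v) (concat_words u' v') = hamming_dist u u' + hamming_dist v v'"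
proof -
  have "{i. concat_words u v $ i \<noteq> concat_words u' v' $ i} =
      {i. u $ i \<noteq> u' $ i} <+> {i. v $ i \<noteq> v' $ i}"
  proof (rule set_eqI)
    fix i
    show "i \<in> {i. concat_words u v $ i \<noteq> concat_words u' v' $ i} \<longleftrightarrow>
        i \<in> {i. u $ i \<noteq> u' $ i} <+> {i. v $ i \<noteq> v' $ i}"
      by (cases i) (auto simp: concat_words_def)
  qed
  then show ?thesis by (simp add: hamming_dist_def card_Plus)
qed

section \<open>Parity and syndrome\<close>

definition syndrome :: "('n::finite \<Rightarrow> bit ^ 'm) \<Rightarrow> bit ^ 'n \<Rightarrow> bit ^ 'm" where
  "syndrome g x = (\<Sum>i\<in>UNIV. x $ i *s g i)"

lemma syndrome_add: "syndrome g (x + y) = syndrome g x + syndrome g y"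
  by (simp only: syndrome_def vector_add_component vector_sadd_rdistrib sum.distrib)

lemma syndrome_eq_sum_support: "syndrome g x = (\<Sum>i\<in>support x. g i)"
proof -
  have "t *s v = (if t = 1 then v else 0)" for t :: bit and v :: "bit ^ 'm"
    by (cases t) (auto simp: vec_eq_iff)
  then have "syndrome g x = (\<Sum>i\<in>UNIV. if x $ i = 1 then g i else 0)"
    unfolding syndrome_def by (intro sum.cong refl)
  then show ?thesis by (simp add: support_def sum.If_cases)
qed

lemma syndrome_axis [simp]: "syndrome g (axis i 1) = g i"
  by (simp add: syndrome_eq_sum_support)

lemma syndrome_0 [simp]: "syndrome g 0 = 0"
  by (simp add: syndrome_eq_sum_support)

definition parity :: "bit ^ 'n::finite \<Rightarrow> bit" where
  "parity x = (\<Sum>i\<in>UNIV. x $ i)"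

lemma parity_add: "parity (x + y) = parity x + parity y"
  by (simp only: parity_def vector_add_component sum.distrib)

lemma parity_axis [simp]: "parity (axis i 1) = 1"
  by (simp add: parity_def axis_def)

lemma parity_eq_0_iff: "parity x = 0 \<longleftrightarrow> even (card (support x))"
proof -
  have "x $ i = (if x $ i = 1 then 1 else 0)" for i by (cases "x $ i") auto
  then have "(\<Sum>i\<in>UNIV. x $ i) = (\<Sum>i\<in>UNIV. if x $ i = 1 then 1 else 0)" by simp
  also have "\<dots> = of_nat (card (support x))" by (simp add: support_def sum.If_cases)
  finally have eq: "parity x = of_nat (card (support x))" unfolding parity_def .
  have "(of_nat k :: bit) = 0 \<longleftrightarrow> even k" for k :: nat
  proof (induction k)
    case (Suc k)
    then show ?case by (cases "of_nat k :: bit") auto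
  qed simp
  then show ?thesis by (simp only: eq)
qed

lemma code_P_eq: "code_P \<alpha> = {x. parity x = 0 \<and> syndrome \<alpha> x = 0}"
  by (simp only: code_P_def parity_def syndrome_def)

lemma mem_code_P_iff: "x \<in> code_P \<alpha> \<longleftrightarrow> even (card (support x)) \<and> syndrome \<alpha> x = 0"
  by (simp add: code_P_eq parity_eq_0_iff)

lemma code_P_add: "x \<in> code_P \<alpha> \<Longrightarrow> y \<in> code_P \<alpha> \<Longrightarrow> x + y \<in> code_P \<alpha>"
  by (simp add: code_P_eq syndrome_add parity_add)

lemma zero_mem_code_P [simp]: "0 \<in> code_P \<alpha>"
  by (simp add: mem_code_P_iff)

lemma even_card_support_add_axes:
  "even (card (support (x + axis i 1 + axis j 1))) \<longleftrightarrow> even (card (support x))"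
  by (simp add: parity_add flip: parity_eq_0_iff)

text \<open>
  Parity excludes odd weights, and a word of weight \<open>2\<close> would make two values of \<open>\<alpha>\<close> coincide.
\<close>

lemma code_P_weight_ge_4:
  assumes "inj \<alpha>" and x: "x \<in> code_P \<alpha>" "x \<noteq> 0"
  shows "4 \<le> card (support x)"
proof (rule ccontr)
  assume "\<not> ?thesis"
  moreover have "card (support x) \<noteq> 0" using x by simp
  moreover have "even (card (support x))" using x by (simp add: mem_code_P_iff)
  ultimately have "card (support x) = 2" by presburger
  then obtain i j where ij: "support x = {i, j}" "i \<noteq> j" by (auto simp: card_2_iff)
  then have "\<alpha> i + \<alpha> j = 0" using x by (simp add: mem_code_P_iff syndrome_eq_sum_support)
  then show False using \<open>inj \<alpha>\<close> ij(2) by (simp add: bit_word_add_eq_0_iff inj_eq)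
qed

text \<open>
  \<open>P\<close> is the kernel of the additive map \<open>L\<close> that sends a word to its parity and its syndrome. An
  explicit section \<open>\<sigma>\<close> of \<open>L\<close> identifies the space of all words with \<open>P\<close> times the range of \<open>L\<close>.
\<close>

lemma code_P_card:
  fixes \<alpha> :: "'n::finite \<Rightarrow> bit ^ 'm::finite"
  assumes "bij \<alpha>"
  shows "card (code_P \<alpha>) * (2 * 2 ^ CARD('m)) = 2 ^ CARD('n)"
proof -
  \<comment> \<open>The first axis word has the right syndrome but odd parity; the axis word at the position that
    \<open>\<alpha>\<close> maps to zero corrects the parity without changing the syndrome.\<close>
  define \<sigma> :: "bit \<times> (bit ^ 'm) \<Rightarrow> bit ^ 'n" where
    "\<sigma> = (\<lambda>(s, v). axis (inv \<alpha> v) 1 + (if s = 0 then axis (inv \<alpha> 0) 1 else 0))"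
  define L :: "bit ^ 'n \<Rightarrow> bit \<times> (bit ^ 'm)" where "L x = (parity x, syndrome \<alpha> x)" for x
  have L_add: "L (x + y) = L x + L y" for x y
    by (simp add: L_def syndrome_add parity_add)
  have \<alpha>_inv: "\<alpha> (inv \<alpha> v) = v" for v
    using assms by (simp add: bij_is_surj surj_f_inv_f)
  have L_\<sigma>: "L (\<sigma> t) = t" for t
  proof (cases t)
    case (Pair s v)
    then show ?thesis
      by (cases s) (simp_all add: \<sigma>_def L_def syndrome_add parity_add \<alpha>_inv)
  qed
  have P: "x \<in> code_P \<alpha> \<longleftrightarrow> L x = 0" for x
    by (simp add: code_P_eq L_def zero_prod_def)
  have self: "t + t = 0" for t :: "bit \<times> (bit ^ 'm)" by (cases t) (simp add: zero_prod_def)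
  have "bij_betw (\<lambda>(p, t). p + \<sigma> t) (code_P \<alpha> \<times> UNIV) UNIV"
  proof (rule bij_betw_byWitness[where f' = "\<lambda>x. (x + \<sigma> (L x), L x)"])
  qed (auto simp: P L_add L_\<sigma> self add.assoc)
  then have "card (code_P \<alpha> \<times> (UNIV :: (bit \<times> (bit ^ 'm)) set)) = CARD(bit ^ 'n)"
    by (rule bij_betw_same_card)
  moreover have "CARD(bit) = 2"
  proof -
    have "(UNIV :: bit set) = {0, 1}" by (auto intro: bit.exhaust)
    then show ?thesis by (simp only: card_2_iff) auto
  qed
  ultimately show ?thesis by (simp add: card_cartesian_product CARD_vec)
qed

section \<open>Consequences of almost perfect nonlinearity\<close>

text \<open>
  If \<open>f\<close> also summed to zero, then \<open>(a, b)\<close>, \<open>(b, a)\<close> and \<open>(c, d)\<close> would be three solutions of one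
  and the same system, against the APN bound of two.
\<close>

lemma APN_sum_nonzero:
  fixes f :: "bit ^ 'm::finite \<Rightarrow> bit ^ 'm"
  assumes "APN f" and dist: "distinct [a, b, c, d]" and sum: "a + b + c + d = 0"
  shows "f a + f b + f c + f d \<noteq> 0"
proof
  assume "f a + f b + f c + f d = 0"
  then have f_eq: "f c + f d = f a + f b"
    by (metis add.assoc bit_word_add_eq_0_iff)
  have eq: "c + d = a + b"
    using sum by (metis add.assoc bit_word_add_eq_0_iff)
  let ?S = "{(x, y). x + y = a + b \<and> f x + f y = f a + f b}"
  have "a + b \<noteq> 0" using dist by (simp add: bit_word_add_eq_0_iff)
  then have "card ?S \<in> {0, 2}" using \<open>APN f\<close> unfolding APN_def by blast
  moreover have "{(a, b), (b, a), (c, d)} \<subseteq> ?S" using eq f_eq by (auto simp: add.commute)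
  then have "card {(a, b), (b, a), (c, d)} \<le> card ?S" by (intro card_mono) auto
  moreover have "card {(a, b), (b, a), (c, d)} = 3" using dist by auto
  ultimately show False by auto
qed

text \<open>
  The words of \<open>P\<close> with zero \<open>f\<close>-syndrome generalize the extended two-error-correcting BCH
  code, which is the case where \<open>f\<close> is cubing in the field of order \<open>2\<^sup>m\<close>.
\<close>

lemma double_syndrome_weight_ge_6:
  fixes \<alpha> :: "'n::finite \<Rightarrow> bit ^ 'm::finite"
  assumes "inj \<alpha>" "APN f" and x: "x \<in> code_P \<alpha>" "x \<noteq> 0" "syndrome (\<lambda>i. f (\<alpha> i)) x = 0"
  shows "6 \<le> card (support x)"
proof (rule ccontr)
  assume "\<not> ?thesis"
  moreover have "4 \<le> card (support x)" using assms by (intro code_P_weight_ge_4)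
  moreover have "even (card (support x))" using x by (simp add: mem_code_P_iff)
  ultimately have "card (support x) = 4" by presburger
  then obtain i j k l where s: "support x = {i, j, k, l}" "distinct [i, j, k, l]"
    by (auto simp: card_Suc_eq numeral_eq_Suc)
  have "\<alpha> i + \<alpha> j + \<alpha> k + \<alpha> l = 0"
    using x s by (simp add: mem_code_P_iff syndrome_eq_sum_support add.assoc)
  moreover have "f (\<alpha> i) + f (\<alpha> j) + f (\<alpha> k) + f (\<alpha> l) = 0"
    using x s by (simp add: syndrome_eq_sum_support add.assoc)
  moreover have "distinct [\<alpha> i, \<alpha> j, \<alpha> k, \<alpha> l]" using s(2) \<open>inj \<alpha>\<close> by (simp add: inj_eq)
  ultimately show False using APN_sum_nonzero[OF \<open>APN f\<close>] by blast
qed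

section \<open>Distances and cardinality of the code\<close>

lemma q_map_eq_add_axis:
  fixes \<alpha> :: "'n::finite \<Rightarrow> bit ^ 'm::finite"
  assumes "bij \<alpha>" "inj f" "p \<in> code_P \<alpha>"
  obtains i where "q_map \<alpha> f p = p + axis i 1" "f (\<alpha> i) = syndrome (\<lambda>i. f (\<alpha> i)) p"
proof -
  have r: "q_map \<alpha> f p \<in> code_Q \<alpha> f \<and> hamming_dist p (q_map \<alpha> f p) = 1"
    unfolding q_map_def by (rule theI') (rule q_map_well_defined[OF assms])
  then obtain i where i: "q_map \<alpha> f p = p + axis i 1" using hamming_dist_1_iff by blast
  have "syndrome (\<lambda>i. f (\<alpha> i)) (q_map \<alpha> f p) = 0"
    using r by (simp add: code_Q_def syndrome_def)
  then have "f (\<alpha> i) = syndrome (\<lambda>i. f (\<alpha> i)) p" by (simp add: i syndrome_add bit_word_add_eq_0_iff)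
  with i that show thesis by blast
qed

text \<open>
  Two pairs with the same sum are equal or disjoint. If the first pair were equal to one of the
  other two, its contribution to the sum of \<open>f\<close> would cancel, and the remaining pair would be
  sent by \<open>f\<close> to two equal values.
\<close>

lemma equal_sum_pairs_distinct:
  fixes a b c d e t :: "bit ^ 'm" and f :: "bit ^ 'm \<Rightarrow> bit ^ 'm"
  assumes "inj f" and "a \<noteq> b"
    and cd: "c + d = a + b" and et: "e + t = a + b"
    and f_sum: "f a + f b + (f c + f d) + (f e + f t) = 0"
    and ne: "{c, d} \<noteq> {e, t}"
  shows "distinct [a, b, c, d, e, t]"
proof -
  have pair: "{u, v} = {x, y}" if "u + v = x + y" "{u, v} \<inter> {x, y} \<noteq> {}" for u v x y :: "bit ^ 'm"
    using that by (auto simp: add.commute)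
  have f_pair: "f u + f v = f x + f y" if "{u, v} = {x, y}" for u v x y
    using that by (auto simp: doubleton_eq_iff add.commute)
  have neq: "c \<noteq> d" "e \<noteq> t" using \<open>a \<noteq> b\<close> cd et by (auto simp: bit_word_add_eq_0_iff)
  have f_neq: "f u + f v \<noteq> 0" if "u \<noteq> v" for u v
    using that \<open>inj f\<close> by (simp add: bit_word_add_eq_0_iff inj_eq)
  have "{a, b} \<inter> {c, d} = {}"
  proof (rule ccontr)
    assume "\<not> ?thesis"
    then have "f a + f b = f c + f d" using pair f_pair cd by metis
    then show False using f_sum f_neq[OF neq(2)] by simp
  qed
  moreover have "{a, b} \<inter> {e, t} = {}"
  proof (rule ccontr)
    assume "\<not> ?thesis"
    then have "f a + f b = f e + f t" using pair f_pair et by metis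
    then show False using f_sum f_neq[OF neq(1)] by (simp add: ac_simps)
  qed
  moreover have "{c, d} \<inter> {e, t} = {}" using pair[of c d e t] ne cd et by auto
  ultimately show ?thesis using neq \<open>a \<noteq> b\<close> by auto
qed

text \<open>
  Here \<open>A\<close> and \<open>B\<close> are the differences of the parameters of two codewords, and \<open>i\<close> and \<open>j\<close> the
  positions in which \<open>q\<close> changes the second parameter of each.
\<close>

lemma difference_weight_ge_6:
  fixes \<alpha> :: "'n::finite \<Rightarrow> bit ^ 'm::finite"
  assumes "inj \<alpha>" "inj f" "APN f"
    and no6: "\<not> (\<exists>a b c d e t. distinct [a, b, c, d, e, t] \<and>
           a + b + c + d = 0 \<and> a + b + e + t = 0 \<and>
           f a + f b + f c + f d + f e + f t = 0)"
    and A: "A \<in> code_P \<alpha>" and B: "B \<in> code_P \<alpha>" and nz: "A \<noteq> 0 \<or> B \<noteq> 0"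
    and ij: "f (\<alpha> i) + f (\<alpha> j) = syndrome (\<lambda>k. f (\<alpha> k)) B"
  shows "6 \<le> card (support (A + axis i 1 + axis j 1)) + card (support (A + B + axis i 1 + axis j 1))"
proof (cases "i = j")
  case True
  then have [simp]: "w + axis i 1 + axis j 1 = w" for w :: "bit ^ 'n" by (simp add: add.assoc)
  show ?thesis
  proof (cases "B = 0")
    case True
    then show ?thesis using code_P_weight_ge_4[OF \<open>inj \<alpha>\<close> A] nz by simp
  next
    case False
    have "6 \<le> card (support B)"
      using ij True by (intro double_syndrome_weight_ge_6[OF \<open>inj \<alpha>\<close> \<open>APN f\<close> B False]) simp
    then show ?thesis using card_support_le_add[of B A] by simp
  qed
next
  case False
  let ?e = "axis i 1 + axis j 1 :: bit ^ 'n"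
  have "\<alpha> i \<noteq> \<alpha> j" using False \<open>inj \<alpha>\<close> by (simp add: inj_eq)
  have "B \<noteq> 0" using ij \<open>\<alpha> i \<noteq> \<alpha> j\<close> \<open>inj f\<close> by (auto simp: bit_word_add_eq_0_iff inj_eq)
  have syn: "syndrome \<alpha> (w + ?e) = \<alpha> i + \<alpha> j" if "w \<in> code_P \<alpha>" for w
    using that by (simp add: syndrome_add mem_code_P_iff)
  have ev: "even (card (support (w + ?e)))" if "w \<in> code_P \<alpha>" for w
    using that even_card_support_add_axes[of w i j] by (simp add: mem_code_P_iff add.assoc)
  have ge2: "2 \<le> card (support (w + ?e))" if "w \<in> code_P \<alpha>" for w
  proof -
    have "w + ?e \<noteq> 0" using syn[OF that] \<open>\<alpha> i \<noteq> \<alpha> j\<close> by (auto simp: bit_word_add_eq_0_iff)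
    then have "card (support (w + ?e)) \<noteq> 0" by simp
    then show ?thesis using ev[OF that] by presburger
  qed
  have AB: "A + B \<in> code_P \<alpha>" using A B by (rule code_P_add)
  have "6 \<le> card (support (A + ?e)) + card (support (A + B + ?e))"
  proof (rule ccontr)
    assume "\<not> ?thesis"
    then have X: "card (support (A + ?e)) = 2" and Y: "card (support (A + B + ?e)) = 2"
      using ge2[OF A] ge2[OF AB] ev[OF A] ev[OF AB] by presburger+
    obtain k l where kl: "support (A + ?e) = {k, l}" "k \<noteq> l" using X by (auto simp: card_2_iff)
    obtain r s where rs: "support (A + B + ?e) = {r, s}" "r \<noteq> s" using Y by (auto simp: card_2_iff)
    have \<alpha>kl: "\<alpha> k + \<alpha> l = \<alpha> i + \<alpha> j"
      using syn[OF A] kl by (simp add: syndrome_eq_sum_support)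
    have \<alpha>rs: "\<alpha> r + \<alpha> s = \<alpha> i + \<alpha> j"
      using syn[OF AB] rs by (simp add: syndrome_eq_sum_support)
    \<comment> \<open>\<open>B\<close> is the sum of the two halves, so its \<open>f\<close>-syndrome can be read off their supports.\<close>
    have B_eq: "B = (A + ?e) + (A + B + ?e)" by (simp add: ac_simps)
    have "syndrome (\<lambda>k. f (\<alpha> k)) B = f (\<alpha> k) + f (\<alpha> l) + (f (\<alpha> r) + f (\<alpha> s))"
      by (subst B_eq, subst syndrome_add) (use kl rs in \<open>simp add: syndrome_eq_sum_support\<close>)
    then have f_sum: "f (\<alpha> i) + f (\<alpha> j) + (f (\<alpha> k) + f (\<alpha> l)) + (f (\<alpha> r) + f (\<alpha> s)) = 0"
      using ij by (metis add.assoc bit_word_add_self)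
    have "{k, l} \<noteq> {r, s}"
    proof
      assume "{k, l} = {r, s}"
      then have "A + ?e = A + B + ?e" using kl rs support_inject by metis
      then show False using \<open>B \<noteq> 0\<close> by (simp add: add.assoc)
    qed
    then have "\<alpha> ` {k, l} \<noteq> \<alpha> ` {r, s}"
      unfolding inj_image_eq_iff[OF \<open>inj \<alpha>\<close>] .
    then have "distinct [\<alpha> i, \<alpha> j, \<alpha> k, \<alpha> l, \<alpha> r, \<alpha> s]"
      by (intro equal_sum_pairs_distinct[OF \<open>inj f\<close> \<open>\<alpha> i \<noteq> \<alpha> j\<close> \<alpha>kl \<alpha>rs f_sum]) simp
    moreover have "\<alpha> i + \<alpha> j + \<alpha> k + \<alpha> l = 0" "\<alpha> i + \<alpha> j + \<alpha> r + \<alpha> s = 0"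
      using \<alpha>kl \<alpha>rs by (metis add.assoc bit_word_add_self)+
    moreover have "f (\<alpha> i) + f (\<alpha> j) + f (\<alpha> k) + f (\<alpha> l) + f (\<alpha> r) + f (\<alpha> s) = 0"
      using f_sum by (simp add: add.assoc)
    ultimately show False using no6 by blast
  qed
  then show ?thesis by (simp only: add.assoc)
qed

text \<open>
  The hypothesis says that \<open>i\<close> is the position in which \<open>q\<close> changes the zero word. With \<open>B\<close> of
  weight \<open>4\<close> and \<open>i\<close> in its support, adding \<open>e\<^sub>i\<close> removes a position, and the weight
  of the second half stays \<open>4\<close> if \<open>j\<close> lies outside the support of \<open>B\<close>.
\<close>

lemma ex_weight_6_difference:
  fixes \<alpha> :: "'n::finite \<Rightarrow> bit ^ 'm::finite"
  assumes "bij \<alpha>" "inj f" "APN f" "CARD('m) \<ge> 2"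
  assumes i: "f (\<alpha> i) = 0"
  obtains B j where "B \<in> code_P \<alpha>" "f (\<alpha> j) = syndrome (\<lambda>k. f (\<alpha> k)) B"
    "card (support (axis i 1 + axis j 1 :: bit ^ 'n)) + card (support (B + axis i 1 + axis j 1)) = 6"
proof -
  obtain s t :: 'm where "s \<noteq> t"
    using assms(4) by (metis One_nat_def card_1_singleton_iff card_2_iff' ex_card subset_UNIV)
  \<comment> \<open>Two independent directions, spanning an affine plane through \<open>\<alpha> i\<close>; its indicator word is \<open>B\<close>.\<close>
  define u :: "bit ^ 'm" where "u = axis s 1"
  define v :: "bit ^ 'm" where "v = axis t 1"
  have "u \<noteq> v" "u \<noteq> 0" "v \<noteq> 0" using \<open>s \<noteq> t\<close> by (auto simp: u_def v_def axis_eq_axis axis_eq_0_iff)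
  have "surj \<alpha>" "inj \<alpha>" using \<open>bij \<alpha>\<close> by (auto simp: bij_def)
  obtain k where k: "\<alpha> k = \<alpha> i + u" using \<open>surj \<alpha>\<close> by (metis surjD)
  obtain l where l: "\<alpha> l = \<alpha> i + v" using \<open>surj \<alpha>\<close> by (metis surjD)
  obtain r where r: "\<alpha> r = \<alpha> i + u + v" using \<open>surj \<alpha>\<close> by (metis surjD)
  have dist\<alpha>: "distinct [\<alpha> i, \<alpha> k, \<alpha> l, \<alpha> r]"
    using \<open>u \<noteq> v\<close> \<open>u \<noteq> 0\<close> \<open>v \<noteq> 0\<close> by (auto simp: k l r add.assoc bit_word_add_eq_0_iff)
  then have dist: "distinct [i, k, l, r]" by auto
  have sum: "\<alpha> i + \<alpha> k + \<alpha> l + \<alpha> r = 0" by (simp add: k l r ac_simps)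
  define B where "B = axis i 1 + axis k 1 + axis l 1 + (axis r 1 :: bit ^ 'n)"
  have sB: "support B = {i, k, l, r}" using dist by (auto simp: B_def support_add)
  have B: "B \<in> code_P \<alpha>"
    using sum dist by (simp add: mem_code_P_iff sB) (simp add: B_def syndrome_add)
  have synB: "syndrome (\<lambda>k. f (\<alpha> k)) B = f (\<alpha> i) + f (\<alpha> k) + f (\<alpha> l) + f (\<alpha> r)"
    by (simp add: B_def syndrome_add)
  have "surj f" using \<open>inj f\<close> by (simp add: finite_UNIV_inj_surj)
  then obtain j where j: "f (\<alpha> j) = syndrome (\<lambda>k. f (\<alpha> k)) B"
    using \<open>surj \<alpha>\<close> by (metis surjD)
  have "j \<noteq> i" using APN_sum_nonzero[OF \<open>APN f\<close> dist\<alpha> sum] i j synB by auto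
  have inj: "f (\<alpha> x) = f (\<alpha> y) \<longleftrightarrow> x = y" for x y
    using \<open>inj f\<close> \<open>inj \<alpha>\<close> by (simp add: inj_eq)
  \<comment> \<open>If \<open>j\<close> were one of \<open>k\<close>, \<open>l\<close>, \<open>r\<close>, then \<open>f\<close> would take the same value at the
    points \<open>\<alpha>\<close> of the other two.\<close>
  have "j \<noteq> k" "j \<noteq> l" "j \<noteq> r"
    using j dist by (auto simp: synB i inj bit_word_add_eq_0_iff add.assoc)
  have "support (B + axis i 1 + axis j 1) = {k, l, r, j}"
    using dist \<open>j \<noteq> i\<close> \<open>j \<noteq> k\<close> \<open>j \<noteq> l\<close> \<open>j \<noteq> r\<close> by (auto simp: support_add sB)
  moreover have "support (axis i 1 + axis j 1 :: bit ^ 'n) = {i, j}"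
    using \<open>j \<noteq> i\<close> by (auto simp: support_add)
  ultimately show thesis
    using dist \<open>j \<noteq> i\<close> \<open>j \<noteq> k\<close> \<open>j \<noteq> l\<close> \<open>j \<noteq> r\<close> by (intro that[OF B j]) auto
qed

theorem theorem5p6:
  fixes \<alpha> :: "'n::finite \<Rightarrow> bit ^ 'm::finite"
    and f :: "bit ^ 'm \<Rightarrow> bit ^ 'm"
    and m n :: nat
  assumes m: "CARD('m) = m" "m \<ge> 2"
    and n: "CARD('n) = n" "n = 2 ^ m"
    and "bij \<alpha>"
    and "inj f" and "APN f"
    and "\<not> (\<exists>a b c d e t. distinct [a, b, c, d, e, t] \<and>
           a + b + c + d = 0 \<and> a + b + e + t = 0 \<and>
           f a + f b + f c + f d + f e + f t = 0)"
  defines "P \<equiv> code_P \<alpha>"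
    and "q \<equiv> q_map \<alpha> f"
  defines "PP \<equiv> {concat_words (a + b + q b) (a + q b) | a b. a \<in> P \<and> b \<in> P}"
  shows "distance_code 6 (PP :: (bit ^ ('n + 'n)) set)
    \<and> CARD('n + 'n) = 2 * n
    \<and> real (card PP) = 2 ^ (2 * n - 2) / real n ^ 2"
proof (intro conjI)
  have "inj \<alpha>" "surj \<alpha>" using \<open>bij \<alpha>\<close> by (auto simp: bij_def)
  let ?w = "\<lambda>(a, b). concat_words (a + b + q b) (a + q b)"
  have PP: "PP = ?w ` (P \<times> P)" by (auto simp: PP_def image_iff)
  have w_inj: "inj ?w"
  proof (rule injI, clarify)
    fix a b a' b' :: "bit ^ 'n"
    assume "concat_words (a + b + q b) (a + q b) = concat_words (a' + b' + q b') (a' + q b')"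
    then have 1: "a + b + q b = a' + b' + q b'" and 2: "a + q b = a' + q b'"
      by (simp_all only: concat_words_inject)
    from 1 have "b + (a + q b) = b' + (a' + q b')" by (simp only: ac_simps)
    then have "b + (a' + q b') = b' + (a' + q b')" by (simp only: 2)
    then have "b = b'" by (rule add_right_imp_eq)
    with 2 show "a = a' \<and> b = b'" by simp
  qed
  have "\<forall>b. \<exists>i. b \<in> P \<longrightarrow> q b = b + axis i 1 \<and> f (\<alpha> i) = syndrome (\<lambda>i. f (\<alpha> i)) b"
    using q_map_eq_add_axis[OF \<open>bij \<alpha>\<close> \<open>inj f\<close>] unfolding P_def q_def by metis
  then obtain pos where q_pos: "\<And>b. b \<in> P \<Longrightarrow> q b = b + axis (pos b) 1"
    and f_pos: "\<And>b. b \<in> P \<Longrightarrow> f (\<alpha> (pos b)) = syndrome (\<lambda>i. f (\<alpha> i)) b"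
    by metis
  have dist: "hamming_dist (?w (a, b)) (?w (a', b')) =
      card (support ((a + a') + axis (pos b) 1 + axis (pos b') 1)) +
      card (support ((a + a') + (b + b') + axis (pos b) 1 + axis (pos b') 1))"
    if "b \<in> P" "b' \<in> P" for a b a' b'
    using that unfolding prod.case hamming_dist_concat_words
    by (simp add: hamming_dist_eq_card_support q_pos ac_simps)
  have ge6: "6 \<le> hamming_dist x y" if xy: "x \<in> PP" "y \<in> PP" "x \<noteq> y" for x y
  proof -
    obtain a b where x: "x = ?w (a, b)" "a \<in> P" "b \<in> P" using xy(1) unfolding PP by blast
    obtain a' b' where y: "y = ?w (a', b')" "a' \<in> P" "b' \<in> P" using xy(2) unfolding PP by blast
    have nz: "a + a' \<noteq> 0 \<or> b + b' \<noteq> 0"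
      using xy(3) unfolding x(1) y(1) bit_word_add_eq_0_iff by blast
    have P: "a + a' \<in> code_P \<alpha>" "b + b' \<in> code_P \<alpha>"
      using x y code_P_add unfolding P_def by blast+
    have "f (\<alpha> (pos b)) + f (\<alpha> (pos b')) = syndrome (\<lambda>k. f (\<alpha> k)) (b + b')"
      by (simp only: f_pos x y syndrome_add)
    from difference_weight_ge_6[OF \<open>inj \<alpha>\<close> \<open>inj f\<close> \<open>APN f\<close> assms(8) P nz this]
    show ?thesis unfolding x(1) y(1) dist[OF x(3) y(3)] .
  qed
  have "0 \<in> P" by (simp add: P_def)
  have f0: "f (\<alpha> (pos 0)) = 0" using f_pos[OF \<open>0 \<in> P\<close>] by simp
  obtain B j where B: "B \<in> P" "f (\<alpha> j) = syndrome (\<lambda>k. f (\<alpha> k)) B"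
    "card (support (axis (pos 0) 1 + axis j 1 :: bit ^ 'n)) +
     card (support (B + axis (pos 0) 1 + axis j 1)) = 6"
    using ex_weight_6_difference[OF \<open>bij \<alpha>\<close> \<open>inj f\<close> \<open>APN f\<close> _ f0] m unfolding P_def by metis
  have "j = pos B" using B f_pos[OF B(1)] \<open>inj f\<close> \<open>inj \<alpha>\<close> by (metis injD)
  then have d6: "hamming_dist (?w (0, 0)) (?w (0, B)) = 6"
    using B(3) by (subst dist[OF \<open>0 \<in> P\<close> B(1)]) simp
  have mem: "?w (0, 0) \<in> PP" "?w (0, B) \<in> PP" using \<open>0 \<in> P\<close> B(1) unfolding PP by blast+
  have neq: "?w (0, 0) \<noteq> ?w (0, B)"
  proof
    assume "?w (0, 0) = ?w (0, B)"
    then show False using d6 by (simp only: hamming_dist_def) simp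
  qed
  show "distance_code 6 PP"
    unfolding distance_code_def
  proof (intro conjI)
    have "card {?w (0, 0), ?w (0, B)} \<le> card PP" using mem by (intro card_mono) auto
    then show "2 \<le> card PP" using neq by simp
    show "6 = Min {hamming_dist x y |x y. x \<in> PP \<and> y \<in> PP \<and> x \<noteq> y}" (is "6 = Min ?D")
    proof (rule Min_eqI[symmetric])
      have "?D \<subseteq> case_prod hamming_dist ` (PP \<times> PP)" by force
      then show "finite ?D" by (rule finite_subset) simp
      show "6 \<le> d" if "d \<in> ?D" for d using that ge6 by blast
      show "6 \<in> ?D" using mem neq d6[symmetric] by blast
    qed
  qed
  show "CARD('n + 'n) = 2 * n" using n by simp
  have "card PP = card P ^ 2"
    unfolding PP by (simp add: card_image inj_on_subset[OF w_inj] card_cartesian_product power2_eq_square)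
  moreover have "card P * (2 * n) = 2 ^ n"
    using code_P_card[OF \<open>bij \<alpha>\<close>] n m unfolding P_def by simp
  then have "real (card P) * (2 * real n) = 2 ^ n"
    by (metis of_nat_mult of_nat_numeral of_nat_power)
  then have "(real (card P) * (2 * real n)) ^ 2 = 2 ^ (2 * n)"
    by (simp add: power_even_eq)
  moreover have "n \<noteq> 0" using n by simp
  moreover have "2 ^ (2 * n) = (2 :: real) ^ (2 * n - 2) * 4"
  proof -
    have "2 * n = (2 * n - 2) + 2" using \<open>n \<noteq> 0\<close> by simp
    then have "(2 :: real) ^ (2 * n) = 2 ^ ((2 * n - 2) + 2)" by (rule arg_cong)
    also have "\<dots> = 2 ^ (2 * n - 2) * 4" by (simp only: power_add) simp
    finally show ?thesis .
  qed
  ultimately show "real (card PP) = 2 ^ (2 * n - 2) / real n ^ 2"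
    by (simp add: field_simps power_mult_distrib)
qed

end
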